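(* Let $X$ be a graph, and let $G$ and $H$ be subgraphs of $X$ with $G \cup H = X$. Suppose that $G \cap H$ is convex in $X$ and that $H$ projects to $G \cap H$. Then \[ \#X = \#G + \#H - \#(G \cap H). \]
   Context: A graph means a finite undirected graph with no loops or multiple edges; it may be disconnected and may have isolated vertices, and the empty graph is allowed. For vertices $x,y$ of a graph $G$, $d_G(x,y)$ is the length of a shortest path from $x$ to $y$ in $G$, or $\infty$ if there is none. Let $Z_G(q)$ be the square matrix over $\mathbb{Z}[q]$, indexed by the vertices of $G$, with $(x,y)$-entry $q^{d_G(x,y)}$, using the convention $q^\infty = 0$. Its determinant has constant term $1$, so $Z_G(q)$ is invertible over the field $\mathbb{Q}(q)$. The magnitude of $G$ is $\#G = \sum_{x,y \in G} Z_G(q)^{-1}(x,y) \in \mathbb{Q}(q)$. For subgraphs $G,H$ of $X$, the subgraphs $G\cup H$ and $G\cap H$ are formed by taking unions, respectively intersections, of the vertex sets and of the edge sets. A subgraph $U$ of $X$ is convex in $X$ if $d_U(u,u') = d_X(u,u')$ for all vertices $u,u'$ of $U$. For a convex subgraph $U$ of a graph $X$, let $X_U$ be the set of vertices of $X$ joined by a path in $X$ to some vertex of $U$. We say $X$ projects to $U$ if for every $x \in X_U$ there is a vertex $\pi(x)$ of $U$ such that $d_X(x,u) = d_X(x,\pi(x)) + d_X(\pi(x),u)$ for all vertices $u$ of $U$. Here the statement is applied to $H$ and its subgraph $G \cap H$. *)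

theory Defs
  imports
    "Graph_Theory.Graph_Theory"
    "HOL-Library.Extended_Nat"
    "HOL-Computational_Algebra.Polynomial_Factorial"
begin

text \<open>
  A finite simple undirected graph is a \<^locale>\<open>pair_graph\<close>: a finite, loop-free digraph without
  multiple arcs whose arc relation is symmetric, an undirected edge between \<open>u\<close> and \<open>v\<close> being the
  pair of arcs \<open>(u, v)\<close>, \<open>(v, u)\<close>. Unions and intersections of arc sets therefore correspond
  exactly to unions and intersections of sets of undirected edges.
\<close>

definition graph_union :: "'a pair_pre_digraph \<Rightarrow> 'a pair_pre_digraph \<Rightarrow> 'a pair_pre_digraph" where
  "graph_union G H = \<lparr> pverts = pverts G \<union> pverts H, parcs = parcs G \<union> parcs H \<rparr>"

definition graph_inter :: "'a pair_pre_digraph \<Rightarrow> 'a pair_pre_digraph \<Rightarrow> 'a pair_pre_digraph" where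
  "graph_inter G H = \<lparr> pverts = pverts G \<inter> pverts H, parcs = parcs G \<inter> parcs H \<rparr>"

definition subgraph_of :: "'a pair_pre_digraph \<Rightarrow> 'a pair_pre_digraph \<Rightarrow> bool" where
  "subgraph_of U X \<longleftrightarrow> pair_graph U \<and> pair_graph X \<and> subgraph (with_proj U) (with_proj X)"

text \<open>The infimum over the empty set is \<open>\<infinity>\<close>, the distance between unconnected vertices.\<close>

definition gdist :: "'a pair_pre_digraph \<Rightarrow> 'a \<Rightarrow> 'a \<Rightarrow> enat" where
  "gdist G x y =
     (INF p \<in> {p. vpath p (with_proj G) \<and> hd p = x \<and> last p = y}. enat (vwalk_length p))"

definition qpow :: "enat \<Rightarrow> int poly" where
  "qpow d = (case d of enat n \<Rightarrow> [:0, 1:] ^ n | \<infinity> \<Rightarrow> 0)"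

definition Zmat :: "'a pair_pre_digraph \<Rightarrow> 'a \<Rightarrow> 'a \<Rightarrow> int poly" where
  "Zmat G x y = qpow (gdist G x y)"

type_synonym ratfun = "rat poly fract"

definition ratfun_of_int_poly :: "int poly \<Rightarrow> ratfun" where
  "ratfun_of_int_poly p = to_fract (map_poly rat_of_int p)"

text \<open>
  The two-sided inverse of a square matrix indexed by the finite set \<open>V\<close>. A matrix is a function
  of two indices; requiring the inverse to vanish outside \<open>V \<times> V\<close> makes it unique as a function.
\<close>

definition is_inverse_on :: "'a set \<Rightarrow> ('a \<Rightarrow> 'a \<Rightarrow> 'k::field) \<Rightarrow> ('a \<Rightarrow> 'a \<Rightarrow> 'k) \<Rightarrow> bool" where
  "is_inverse_on V M W \<longleftrightarrow>
     (\<forall>x y. x \<notin> V \<or> y \<notin> V \<longrightarrow> W x y = 0) \<and>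
     (\<forall>x\<in>V. \<forall>y\<in>V. (\<Sum>z\<in>V. M x z * W z y) = (if x = y then 1 else 0)) \<and>
     (\<forall>x\<in>V. \<forall>y\<in>V. (\<Sum>z\<in>V. W x z * M z y) = (if x = y then 1 else 0))"

definition inverse_on :: "'a set \<Rightarrow> ('a \<Rightarrow> 'a \<Rightarrow> 'k::field) \<Rightarrow> 'a \<Rightarrow> 'a \<Rightarrow> 'k" where
  "inverse_on V M = (THE W. is_inverse_on V M W)"

definition magnitude :: "'a pair_pre_digraph \<Rightarrow> ratfun" where
  "magnitude G =
     (\<Sum>x\<in>pverts G. \<Sum>y\<in>pverts G.
        inverse_on (pverts G) (\<lambda>u v. ratfun_of_int_poly (Zmat G u v)) x y)"

definition convex_in :: "'a pair_pre_digraph \<Rightarrow> 'a pair_pre_digraph \<Rightarrow> bool" where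
  "convex_in U X \<longleftrightarrow>
     subgraph_of U X \<and> (\<forall>u\<in>pverts U. \<forall>u'\<in>pverts U. gdist U u u' = gdist X u u')"

definition joined_verts :: "'a pair_pre_digraph \<Rightarrow> 'a pair_pre_digraph \<Rightarrow> 'a set" where
  "joined_verts X U =
     {x \<in> pverts X. \<exists>u\<in>pverts U. \<exists>p. vpath p (with_proj X) \<and> hd p = x \<and> last p = u}"

text \<open>
  The notion is meant for convex \<open>U\<close> only; convexity is kept as a separate condition
  \<^const>\<open>convex_in\<close>. All distances are those of \<open>X\<close>, possibly infinite.
\<close>

definition projects_to :: "'a pair_pre_digraph \<Rightarrow> 'a pair_pre_digraph \<Rightarrow> bool" where
  "projects_to X U \<longleftrightarrow>
     (\<forall>x\<in>joined_verts X U. \<exists>p\<in>pverts U. \<forall>u\<in>pverts U. gdist X x u = gdist X x p + gdist X p u)"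

end

theory Submission
  imports Defs "Jordan_Normal_Form.Char_Poly"
begin

text \<open>
  The magnitude is the total of the unique weighting \<open>w\<close>, the solution of \<open>Z w = 1\<close>; the matrix
  \<open>Z\<close> is invertible because it specialises to the identity at \<open>q = 0\<close>. Write \<open>U\<close> for the
  intersection. Convexity of \<open>U\<close> makes \<open>G\<close> and \<open>H\<close> convex in \<open>X\<close> and lets every geodesic
  between \<open>H\<close> and \<open>G\<close> pass through \<open>U\<close>. With the projection this gives
  \<open>d(h, g) = d(h, \<pi> h) + d(\<pi> h, g)\<close>, that is, a factorisation of the block of \<open>Z\<close> between
  \<open>H\<close> and \<open>G\<close> as \<open>P\<close> times the block between \<open>U\<close> and \<open>G\<close>, where the row of \<open>P\<close> at a vertex
  not joined to \<open>U\<close> is zero. It follows that the weightings of \<open>G\<close> and \<open>H\<close>, extended by zero,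
  add up to that of \<open>X\<close> after subtracting the one of \<open>U\<close>.
\<close>

section \<open>Distances as least exponents of powers of the arc relation\<close>

lemma length_vwalk_to_vpath: "length (vwalk_to_vpath p) \<le> length p"
proof (induct p rule: vwalk_to_vpath_induct3)
  case (in_set x xs)
  then show ?case
    using length_dropWhile_le[of "\<lambda>y. y \<noteq> x" xs] by simp
qed auto

text \<open>A walk is recorded by its nonempty list of vertices, so it has one arc fewer than the
  list has entries.\<close>

lemma vwalk_relpow:
  assumes "vwalk p (with_proj G)"
  shows "(hd p, last p) \<in> parcs G ^^ (length p - 1)"
  using assms
proof (induct p rule: vwalk_induct)
  case (Cons u v es)
  then show ?case by (auto intro: relpow_Suc_I2 simp del: relpow.simps)
qed auto

lemma relpow_vwalk:
  assumes "pair_graph G" "x \<in> pverts G" "(x, y) \<in> parcs G ^^ k"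
  shows "\<exists>p. vwalk p (with_proj G) \<and> hd p = x \<and> last p = y \<and> length p = Suc k"
  using assms(2,3)
proof (induct k arbitrary: x)
  case 0
  then show ?case by (intro exI[of _ "[x]"]) (auto simp: vwalk_def)
next
  case (Suc k)
  interpret pair_graph G by fact
  from Suc.prems obtain z where z: "(x, z) \<in> parcs G" "(z, y) \<in> parcs G ^^ k"
    by (meson relpow_Suc_D2)
  then obtain p where p: "vwalk p (with_proj G)" "hd p = z" "last p = y" "length p = Suc k"
    using Suc.hyps[of z] in_arcsD2 by blast
  have "vwalk (x # p) (with_proj G)"
    using p z Suc.prems by (intro vwalk_consI) auto
  with p show ?case by (intro exI[of _ "x # p"]) auto
qed

text \<open>Removing cycles from a walk does not lengthen it, so paths may be traded for powers of
  the arc relation, which concatenate and reverse easily. \<open>x\<close> must be a vertex: the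
  zeroth power relates everything to itself, but no path starts outside the graph.\<close>

lemma gdist_le_iff:
  assumes "pair_graph G" "x \<in> pverts G"
  shows "gdist G x y \<le> enat n \<longleftrightarrow> (\<exists>k\<le>n. (x, y) \<in> parcs G ^^ k)"
proof
  let ?P = "{p. vpath p (with_proj G) \<and> hd p = x \<and> last p = y}"
  assume le: "gdist G x y \<le> enat n"
  have "?P \<noteq> {}"
  proof
    assume "?P = {}"
    then have "gdist G x y = \<infinity>" by (simp only: gdist_def INF_empty top_enat_def)
    with le show False by simp
  qed
  then obtain r where "r \<in> ?P" by blast
  then have "gdist G x y \<in> (\<lambda>p. enat (vwalk_length p)) ` ?P"
    unfolding gdist_def by (rule wellorder_InfI[OF imageI])
  then obtain p where p: "p \<in> ?P" "gdist G x y = enat (vwalk_length p)"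
    by blast
  then show "\<exists>k\<le>n. (x, y) \<in> parcs G ^^ k"
    using le vwalk_relpow[of p G]
    by (intro exI[of _ "length p - 1"]) (auto simp: vpath_def)
next
  assume "\<exists>k\<le>n. (x, y) \<in> parcs G ^^ k"
  then obtain k where "k \<le> n" "(x, y) \<in> parcs G ^^ k" by blast
  with relpow_vwalk[OF assms] obtain p where p: "vwalk p (with_proj G)" "hd p = x" "last p = y"
    "length p = Suc k" by blast
  let ?q = "vwalk_to_vpath p"
  have q: "vpath ?q (with_proj G)" "hd ?q = x" "last ?q = y"
    using p vwalk_to_vpath_vpath[OF p(1)] by (auto simp: vwalk_to_vpath_hd vwalk_to_vpath_last)
  then have "gdist G x y \<le> enat (vwalk_length ?q)"
    unfolding gdist_def by (intro INF_lower) auto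
  also have "\<dots> \<le> enat n"
    using length_vwalk_to_vpath[of p] p \<open>k \<le> n\<close> by simp
  finally show "gdist G x y \<le> enat n" .
qed

lemma gdist_relpow:
  assumes "pair_graph G" "x \<in> pverts G" "gdist G x y = enat n"
  shows "(x, y) \<in> parcs G ^^ n"
proof -
  obtain k where k: "k \<le> n" "(x, y) \<in> parcs G ^^ k"
    using gdist_le_iff[OF assms(1,2), of y n] assms(3) by auto
  then have "gdist G x y \<le> enat k" using gdist_le_iff[OF assms(1,2)] by blast
  with k assms(3) show ?thesis by auto
qed

lemma gdist_leI:
  assumes "pair_graph G" "x \<in> pverts G" "(x, y) \<in> parcs G ^^ n"
  shows "gdist G x y \<le> enat n"
  using gdist_le_iff[OF assms(1,2)] assms(3) by blast

lemma gdist_greatest: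
  assumes "pair_graph G" "x \<in> pverts G" "\<And>n. (x, y) \<in> parcs G ^^ n \<Longrightarrow> c \<le> enat n"
  shows "c \<le> gdist G x y"
proof (cases "gdist G x y")
  case (enat n)
  then show ?thesis using assms(3) gdist_relpow[OF assms(1,2)] by simp
qed simp

lemma gdist_self:
  assumes "pair_graph G" "x \<in> pverts G"
  shows "gdist G x x = 0"
  using gdist_leI[OF assms, of x 0] by (simp add: zero_enat_def[symmetric])

lemma gdist_eq_0_iff:
  assumes "pair_graph G" "x \<in> pverts G"
  shows "gdist G x y = 0 \<longleftrightarrow> x = y"
  using gdist_relpow[OF assms, of y 0] gdist_self[OF assms] by (auto simp: zero_enat_def)

lemma gdist_triangle:
  assumes "pair_graph G" "x \<in> pverts G" "y \<in> pverts G"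
  shows "gdist G x z \<le> gdist G x y + gdist G y z"
proof (cases "gdist G x y = \<infinity> \<or> gdist G y z = \<infinity>")
  case False
  then obtain m n where mn: "gdist G x y = enat m" "gdist G y z = enat n" by auto
  then have "(x, z) \<in> parcs G ^^ (m + n)"
    using gdist_relpow[OF assms(1,2) mn(1)] gdist_relpow[OF assms(1,3) mn(2)]
    by (simp add: relpow_add relcomp.relcompI)
  then show ?thesis using gdist_leI[OF assms(1,2), of z "m + n"] mn by simp
qed auto

lemma sym_relpow:
  assumes "sym R"
  shows "sym (R ^^ n)"
proof (induct n)
  case (Suc n)
  show ?case
  proof (rule symI)
    fix a b assume "(a, b) \<in> R ^^ Suc n"
    then obtain c where "(a, c) \<in> R ^^ n" "(c, b) \<in> R" by (rule relpow_Suc_E)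
    with Suc assms show "(b, a) \<in> R ^^ Suc n"
      by (meson relpow_Suc_I2 symD)
  qed
qed (simp add: sym_Id)

lemma gdist_commute:
  assumes "pair_graph G" "x \<in> pverts G" "y \<in> pverts G"
  shows "gdist G x y = gdist G y x"
proof -
  interpret pair_graph G by fact
  have "sym (parcs G)"
    using pair_sym_arcs by (auto simp: symmetric_def)
  then have rev: "(a, b) \<in> parcs G ^^ n \<Longrightarrow> (b, a) \<in> parcs G ^^ n" for a b n
    using sym_relpow by (meson symD)
  have "gdist G a b \<le> gdist G b a" if "a \<in> pverts G" "b \<in> pverts G" for a b
    using gdist_greatest[OF assms(1) that(2)] gdist_leI[OF assms(1) that(1)] rev by blast
  with assms show ?thesis by (simp add: antisym)
qed

text \<open>Carries a bound on a route one arc backwards in an induction on walks. The summand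
  \<open>c\<close> holds the remaining leg of a route through an intermediate vertex;
  \<open>c = 0\<close> covers a direct route.\<close>

lemma gdist_step:
  assumes "pair_graph G" "(x, y) \<in> parcs G" "gdist G y z + c \<le> enat n"
  shows "gdist G x z + c \<le> enat (Suc n)"
proof -
  interpret pair_graph G by fact
  have v: "x \<in> pverts G" "y \<in> pverts G"
    using assms(2) in_arcsD1 in_arcsD2 by auto
  have "gdist G x y \<le> enat 1" using assms(1,2) v by (intro gdist_leI) auto
  then have "gdist G x z + c \<le> enat 1 + (gdist G y z + c)"
    by (metis gdist_triangle[OF assms(1) v] add.assoc add_right_mono order_trans)
  also have "\<dots> \<le> enat 1 + enat n" using assms(3) by (intro add_left_mono)
  finally show ?thesis by simp
qed

lemma gdist_mono:
  assumes "pair_graph G" "pair_graph X" "parcs G \<subseteq> parcs X" "pverts G \<subseteq> pverts X"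
    and "x \<in> pverts G"
  shows "gdist X x y \<le> gdist G x y"
proof (rule gdist_greatest[OF assms(1,5)])
  fix n assume "(x, y) \<in> parcs G ^^ n"
  moreover have "parcs G ^^ n \<subseteq> parcs X ^^ n"
    by (induct n) (use assms(3) in \<open>auto intro!: relcomp_mono\<close>)
  ultimately show "gdist X x y \<le> enat n" using assms by (intro gdist_leI) auto
qed

section \<open>Inverses of matrices indexed by a finite set, and linear systems\<close>

lemma is_inverse_on_unique:
  assumes "is_inverse_on V M W" "is_inverse_on V M W'" "finite V"
  shows "W = W'"
proof (intro ext)
  fix x y
  show "W x y = W' x y"
  proof (cases "x \<in> V \<and> y \<in> V")
    case True
    have "W x y = (\<Sum>z\<in>V. W x z * (if z = y then 1 else 0))"
      using True assms(3) by (simp add: if_distrib[of "(*) _"] cong: if_cong)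
    also have "\<dots> = (\<Sum>z\<in>V. W x z * (\<Sum>t\<in>V. M z t * W' t y))"
      using True assms(2) by (intro sum.cong) (auto simp: is_inverse_on_def)
    also have "\<dots> = (\<Sum>t\<in>V. (\<Sum>z\<in>V. W x z * M z t) * W' t y)"
      unfolding sum_distrib_left sum_distrib_right mult.assoc by (rule sum.swap)
    also have "\<dots> = (\<Sum>t\<in>V. (if x = t then 1 else 0) * W' t y)"
      using True assms(1) by (intro sum.cong) (auto simp: is_inverse_on_def)
    also have "\<dots> = W' x y"
      using True assms(3) by (simp add: if_distrib[of "\<lambda>c. c * _"] cong: if_cong)
    finally show ?thesis .
  next
    case False
    \<comment> \<open>Off \<open>V \<times> V\<close> both inverses are zero by definition.\<close>
    then show ?thesis using assms unfolding is_inverse_on_def by metis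
  qed
qed

lemma inverse_on_eqI:
  assumes "is_inverse_on V M W" "finite V"
  shows "inverse_on V M = W"
  unfolding inverse_on_def
  using assms is_inverse_on_unique by (intro the_equality) blast+

text \<open>From left to right, \<open>W\<close> as a left inverse gives uniqueness of solutions;
  from right to left, \<open>W\<close> as a right inverse gives existence.\<close>

lemma is_inverse_on_solve:
  assumes W: "is_inverse_on V M W" and V: "finite V"
  shows "(\<forall>x\<in>V. (\<Sum>y\<in>V. M x y * w y) = c x) \<longleftrightarrow> (\<forall>x\<in>V. w x = (\<Sum>y\<in>V. W x y * c y))"
    (is "?L \<longleftrightarrow> ?R")
proof
  assume L: ?L
  show ?R
  proof
    fix x assume x: "x \<in> V"
    have "(\<Sum>y\<in>V. W x y * c y) = (\<Sum>y\<in>V. W x y * (\<Sum>z\<in>V. M y z * w z))"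
      using L by (intro sum.cong) auto
    also have "\<dots> = (\<Sum>z\<in>V. (\<Sum>y\<in>V. W x y * M y z) * w z)"
      unfolding sum_distrib_left sum_distrib_right mult.assoc by (rule sum.swap)
    also have "\<dots> = (\<Sum>z\<in>V. (if x = z then 1 else 0) * w z)"
      using x W by (intro sum.cong) (auto simp: is_inverse_on_def)
    also have "\<dots> = w x"
      using x V by (simp add: if_distrib[of "\<lambda>c. c * _"] cong: if_cong)
    finally show "w x = (\<Sum>y\<in>V. W x y * c y)" by simp
  qed
next
  assume R: ?R
  show ?L
  proof
    fix x assume x: "x \<in> V"
    have "(\<Sum>y\<in>V. M x y * w y) = (\<Sum>y\<in>V. M x y * (\<Sum>z\<in>V. W y z * c z))"
      using R by (intro sum.cong) auto
    also have "\<dots> = (\<Sum>z\<in>V. (\<Sum>y\<in>V. M x y * W y z) * c z)"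
      unfolding sum_distrib_left sum_distrib_right mult.assoc by (rule sum.swap)
    also have "\<dots> = (\<Sum>z\<in>V. (if x = z then 1 else 0) * c z)"
      using x W by (intro sum.cong) (auto simp: is_inverse_on_def)
    also have "\<dots> = c x"
      using x V by (simp add: if_distrib[of "\<lambda>c. c * _"] cong: if_cong)
    finally show "(\<Sum>y\<in>V. M x y * w y) = c x" .
  qed
qed

text \<open>The enumeration \<open>e\<close> turns \<open>M\<close> into an ordinary square matrix;
  its adjugate divided by its determinant is the inverse, carried back along \<open>e\<close> and
  extended by zero.\<close>

lemma ex_is_inverse_on:
  assumes e: "bij_betw e {0..<n} V"
    and "det (mat n n (\<lambda>(i, j). M (e i) (e j))) \<noteq> 0"
  shows "\<exists>W. is_inverse_on V M W"
proof -
  define B where "B = mat n n (\<lambda>(i, j). M (e i) (e j))"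
  define C where "C = (1 / det B) \<cdot>\<^sub>m adj_mat B"
  define g where "g = inv_into {0..<n} e"
  define W where "W x y = (if x \<in> V \<and> y \<in> V then C $$ (g x, g y) else 0)" for x y
  have B: "B \<in> carrier_mat n n" by (simp add: B_def)
  have C: "C \<in> carrier_mat n n" using adj_mat(1)[OF B] by (simp add: C_def)
  have BC: "B * C = 1\<^sub>m n" "C * B = 1\<^sub>m n"
    using adj_mat[OF B] assms(2)[folded B_def]
    by (simp_all add: C_def mult_smult_distrib[OF B] mult_smult_assoc_mat[OF _ B])
      (auto intro!: eq_matI)
  have ge: "g (e i) = i" if "i < n" for i
    using that e by (auto simp: g_def bij_betw_def)
  have eV: "e i \<in> V" if "i < n" for i
    using that e by (auto simp: bij_betw_def)
  have ex: "\<exists>i<n. x = e i" if "x \<in> V" for x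
    using that e by (auto simp: bij_betw_def)
  have sum_V: "sum f V = (\<Sum>k\<in>{0..<n}. f (e k))" for f :: "'a \<Rightarrow> 'b"
    using sum.reindex_bij_betw[OF e, of f] by simp
  have inj: "e i = e j \<longleftrightarrow> i = j" if "i < n" "j < n" for i j
    using that ge by metis
  have 1: "(\<Sum>k\<in>{0..<n}. M (e i) (e k) * C $$ (k, j)) = (if i = j then 1 else 0)"
    if "i < n" "j < n" for i j
  proof -
    have "(B * C) $$ (i, j) = (\<Sum>k\<in>{0..<n}. B $$ (i, k) * C $$ (k, j))"
      using that B C by (simp add: scalar_prod_def)
    with that show ?thesis unfolding BC by (simp add: B_def)
  qed
  have 2: "(\<Sum>k\<in>{0..<n}. C $$ (i, k) * M (e k) (e j)) = (if i = j then 1 else 0)"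
    if "i < n" "j < n" for i j
  proof -
    have "(C * B) $$ (i, j) = (\<Sum>k\<in>{0..<n}. C $$ (i, k) * B $$ (k, j))"
      using that B C by (simp add: scalar_prod_def)
    with that show ?thesis unfolding BC by (simp add: B_def)
  qed
  have "is_inverse_on V M W"
    unfolding is_inverse_on_def
  proof (intro conjI ballI allI impI)
    fix x y assume "x \<in> V" "y \<in> V"
    then obtain i j where ij: "i < n" "j < n" "x = e i" "y = e j" using ex by metis
    show "(\<Sum>z\<in>V. M x z * W z y) = (if x = y then 1 else 0)"
      unfolding sum_V ij(3,4) using 1[of i j] ij inj by (simp add: W_def ge eV)
    show "(\<Sum>z\<in>V. W x z * M z y) = (if x = y then 1 else 0)"
      unfolding sum_V ij(3,4) using 2[of i j] ij inj by (simp add: W_def ge eV)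
  qed (auto simp: W_def)
  then show ?thesis by blast
qed

section \<open>Invertibility over the field of rational functions\<close>

interpretation ratfun_of_int_poly: comm_ring_hom ratfun_of_int_poly
  by unfold_locales (auto simp: ratfun_of_int_poly_def of_int_poly_hom.hom_add of_int_poly_hom.hom_mult)

lemma ratfun_of_int_poly_eq_0_iff: "ratfun_of_int_poly p = 0 \<longleftrightarrow> p = 0"
  by (simp add: ratfun_of_int_poly_def)

text \<open>The determinant is first taken over \<open>int poly\<close>, where evaluation at 0 is a
  ring homomorphism and shows that its constant term is 1. Only its nonvanishing is then carried
  along the injective map into \<open>ratfun\<close>.\<close>

lemma ex_is_inverse_on_ratfun:
  fixes f :: "'a \<Rightarrow> 'a \<Rightarrow> int poly"
  assumes "finite V" "\<And>x y. x \<in> V \<Longrightarrow> y \<in> V \<Longrightarrow> poly (f x y) 0 = (if x = y then 1 else 0)"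
  shows "\<exists>W. is_inverse_on V (\<lambda>x y. ratfun_of_int_poly (f x y)) W"
proof -
  obtain e where e: "bij_betw e {0..<card V} V"
    using ex_bij_betw_nat_finite[OF assms(1)] by blast
  define A where "A = mat (card V) (card V) (\<lambda>(i, j). f (e i) (e j))"
  have "map_mat (\<lambda>p. poly p 0) A = 1\<^sub>m (card V)"
    using assms(2) bij_betwE[OF e] bij_betw_imp_inj_on[OF e]
    by (intro eq_matI) (auto simp: A_def inj_on_eq_iff)
  then have "poly (det A) 0 = 1"
    by (simp flip: comm_ring_hom.hom_det[OF poly_hom.comm_ring_hom_axioms])
  then have "det A \<noteq> 0" by auto
  moreover have "mat (card V) (card V) (\<lambda>(i, j). ratfun_of_int_poly (f (e i) (e j)))
      = map_mat ratfun_of_int_poly A"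
    by (intro eq_matI) (auto simp: A_def)
  ultimately show ?thesis
    by (intro ex_is_inverse_on[OF e]) (simp add: ratfun_of_int_poly_eq_0_iff)
qed

section \<open>Weightings and the magnitude\<close>

definition zeta :: "'a pair_pre_digraph \<Rightarrow> 'a \<Rightarrow> 'a \<Rightarrow> ratfun" where
  "zeta G x y = ratfun_of_int_poly (Zmat G x y)"

definition weighting_on :: "'a set \<Rightarrow> ('a \<Rightarrow> 'a \<Rightarrow> 'k::field) \<Rightarrow> ('a \<Rightarrow> 'k) \<Rightarrow> bool" where
  "weighting_on V M w \<longleftrightarrow> (\<forall>x\<in>V. (\<Sum>y\<in>V. M x y * w y) = 1)"

text \<open>The value 0 at \<open>\<infinity>\<close> keeps this true for infinite summands. It
  turns additive distances into products of matrix entries.\<close>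

lemma qpow_add: "qpow (a + b) = qpow a * qpow b"
  by (cases a; cases b) (auto simp: qpow_def power_add)

lemma finite_pverts: "pair_graph G \<Longrightarrow> finite (pverts G)"
  by (simp add: pair_graph_def pair_digraph_def pair_fin_digraph.pair_finite_verts)

lemma ex_is_inverse_on_zeta:
  assumes "pair_graph G"
  shows "\<exists>W. is_inverse_on (pverts G) (zeta G) W"
proof -
  \<comment> \<open>Positive and infinite distances both give constant term 0, and distance zero
    occurs only on the diagonal.\<close>
  have "poly (Zmat G x y) 0 = (if x = y then 1 else 0)" if "x \<in> pverts G" for x y
    using gdist_eq_0_iff[OF assms that, of y]
    by (auto simp: Zmat_def qpow_def zero_enat_def poly_power split: enat.split)
  then show ?thesis
    unfolding zeta_def by (intro ex_is_inverse_on_ratfun finite_pverts[OF assms]) auto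
qed

text \<open>The value of a weighting at \<open>x\<close> is the row sum of the inverse at
  \<open>x\<close>, so its total is the sum of all entries.\<close>

lemma magnitude_eq_sum_weighting:
  assumes "pair_graph G" "weighting_on (pverts G) (zeta G) w"
  shows "magnitude G = (\<Sum>x\<in>pverts G. w x)"
proof -
  have fin: "finite (pverts G)"
    using assms finite_pverts by blast
  obtain W where W: "is_inverse_on (pverts G) (zeta G) W"
    using ex_is_inverse_on_zeta[OF assms(1)] by blast
  have "w x = (\<Sum>y\<in>pverts G. W x y * 1)" if "x \<in> pverts G" for x
    using is_inverse_on_solve[OF W fin, of w "\<lambda>_. 1"] assms(2) that
    by (auto simp: weighting_on_def)
  moreover have "inverse_on (pverts G) (\<lambda>u v. ratfun_of_int_poly (Zmat G u v)) = W"
    using inverse_on_eqI[OF W fin] by (simp add: zeta_def[abs_def])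
  ultimately show ?thesis by (simp add: magnitude_def)
qed

lemma ex_weighting_on_zeta:
  assumes "pair_graph G"
  shows "\<exists>w. weighting_on (pverts G) (zeta G) w"
proof -
  have fin: "finite (pverts G)"
    using assms finite_pverts by blast
  obtain W where W: "is_inverse_on (pverts G) (zeta G) W"
    using ex_is_inverse_on_zeta[OF assms(1)] by blast
  show ?thesis
    using is_inverse_on_solve[OF W fin, of "\<lambda>x. \<Sum>y\<in>pverts G. W x y * 1" "\<lambda>_. 1"]
    by (auto simp: weighting_on_def)
qed

lemma weighting_on_cong:
  assumes "\<And>x y. x \<in> V \<Longrightarrow> y \<in> V \<Longrightarrow> M x y = M' x y"
  shows "weighting_on V M w \<longleftrightarrow> weighting_on V M' w"
  using assms by (simp add: weighting_on_def cong: sum.cong)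

lemma is_inverse_on_cong:
  assumes "\<And>x y. x \<in> V \<Longrightarrow> y \<in> V \<Longrightarrow> M x y = M' x y"
  shows "is_inverse_on V M W \<longleftrightarrow> is_inverse_on V M' W"
  using assms by (simp add: is_inverse_on_def cong: sum.cong)

text \<open>
  Pushing \<open>b\<close> forward along \<open>P\<close> gives a weighting on the intersection, which is \<open>c\<close> by
  uniqueness. So on either side the contributions of the other side and of the intersection cancel.
\<close>
lemma weighting_on_glue:
  fixes Z :: "'a \<Rightarrow> 'a \<Rightarrow> 'k::field"
  assumes fin: "finite A" "finite B"
    and sym: "\<And>x y. x \<in> A \<union> B \<Longrightarrow> y \<in> A \<union> B \<Longrightarrow> Z x y = Z y x"
    and W: "is_inverse_on (A \<inter> B) Z W"
    and P: "\<And>h g. h \<in> B \<Longrightarrow> g \<in> A \<Longrightarrow> Z h g = (\<Sum>u\<in>A \<inter> B. P h u * Z u g)"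
    and a: "weighting_on A Z a" and b: "weighting_on B Z b" and c: "weighting_on (A \<inter> B) Z c"
  shows "weighting_on (A \<union> B) Z
    (\<lambda>x. (if x \<in> A then a x else 0) + (if x \<in> B then b x else 0)
      - (if x \<in> A \<inter> B then c x else 0))"
proof -
  let ?U = "A \<inter> B"
  \<comment> \<open>The factorisation concerns entries from \<open>B\<close> to \<open>A\<close>, so
    symmetry of \<open>Z\<close> is used once to reach it and once to return to row
    \<open>g\<close>.\<close>
  have push: "(\<Sum>h\<in>B. Z g h * b h) = (\<Sum>u\<in>?U. Z g u * (\<Sum>h\<in>B. P h u * b h))"
    if g: "g \<in> A" for g
  proof -
    have "(\<Sum>h\<in>B. Z g h * b h) = (\<Sum>h\<in>B. (\<Sum>u\<in>?U. P h u * Z u g) * b h)"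
      using g sym P by (intro sum.cong) auto
    also have "\<dots> = (\<Sum>h\<in>B. (\<Sum>u\<in>?U. P h u * Z g u) * b h)"
      using g sym by (intro sum.cong arg_cong2[of _ _ _ _ "(*)"]) auto
    also have "\<dots> = (\<Sum>u\<in>?U. Z g u * (\<Sum>h\<in>B. P h u * b h))"
      unfolding sum_distrib_left sum_distrib_right
      by (subst sum.swap) (simp add: mult_ac)
    finally show ?thesis .
  qed
  have "(\<Sum>u\<in>?U. Z x u * (\<Sum>h\<in>B. P h u * b h)) = 1" if "x \<in> ?U" for x
    using push[of x] that b by (simp add: weighting_on_def)
  then have pb: "(\<Sum>h\<in>B. P h u * b h) = c u" if "u \<in> ?U" for u
    using is_inverse_on_solve[OF W, of "\<lambda>u. \<Sum>h\<in>B. P h u * b h" "\<lambda>_. 1"]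
      is_inverse_on_solve[OF W, of c "\<lambda>_. 1"] c that fin
    by (auto simp: weighting_on_def)
  have A: "(\<Sum>h\<in>B. Z g h * b h) = (\<Sum>u\<in>?U. Z g u * c u)" if "g \<in> A" for g
    unfolding push[OF that] using pb by (intro sum.cong) auto
  \<comment> \<open>Used with \<open>V = A\<close> and \<open>w = a\<close>, then with
    \<open>V = ?U\<close> and \<open>w = c\<close>. In both cases the inner sums are 1, so the two
    left sides agree.\<close>
  have pull: "(\<Sum>g\<in>V. Z h g * w g) = (\<Sum>u\<in>?U. P h u * (\<Sum>g\<in>V. Z u g * w g))"
    if "h \<in> B" "V \<subseteq> A" for h V w
  proof -
    have "(\<Sum>g\<in>V. Z h g * w g) = (\<Sum>g\<in>V. (\<Sum>u\<in>?U. P h u * Z u g) * w g)"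
      using that P by (intro sum.cong) auto
    also have "\<dots> = (\<Sum>u\<in>?U. P h u * (\<Sum>g\<in>V. Z u g * w g))"
      unfolding sum_distrib_left sum_distrib_right mult.assoc by (rule sum.swap)
    finally show ?thesis .
  qed
  have B: "(\<Sum>g\<in>A. Z h g * a g) = (\<Sum>u\<in>?U. Z h u * c u)" if "h \<in> B" for h
  proof -
    have "(\<Sum>g\<in>A. Z h g * a g) = (\<Sum>u\<in>?U. P h u * (\<Sum>g\<in>A. Z u g * a g))"
      by (rule pull[OF that]) auto
    also have "\<dots> = (\<Sum>u\<in>?U. P h u * (\<Sum>g\<in>?U. Z u g * c g))"
      using a c by (intro sum.cong) (auto simp: weighting_on_def)
    also have "\<dots> = (\<Sum>u\<in>?U. Z h u * c u)"
      by (rule pull[OF that, symmetric]) auto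
    finally show ?thesis .
  qed
  have ext: "(\<Sum>y\<in>A \<union> B. Z x y * (if y \<in> V then w y else 0)) = (\<Sum>y\<in>V. Z x y * w y)"
    if "V \<subseteq> A \<union> B" for x V w
    using that fin by (intro sum.mono_neutral_cong_right) auto
  have "(\<Sum>y\<in>A. Z x y * a y) + (\<Sum>y\<in>B. Z x y * b y) - (\<Sum>y\<in>?U. Z x y * c y) = 1"
    if "x \<in> A \<union> B" for x
    using that A[of x] B[of x] a b by (auto simp: weighting_on_def)
  moreover have "(\<Sum>y\<in>A \<union> B. Z x y * ((if y \<in> A then a y else 0) + (if y \<in> B then b y else 0)
        - (if y \<in> ?U then c y else 0)))
      = (\<Sum>y\<in>A. Z x y * a y) + (\<Sum>y\<in>B. Z x y * b y) - (\<Sum>y\<in>?U. Z x y * c y)" for x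
    unfolding ring_distribs sum.distrib sum_subtractf
    by (simp only: ext Un_upper1 Un_upper2 le_supI1 Int_lower1)
  ultimately show ?thesis by (simp add: weighting_on_def)
qed

section \<open>Distances in a union of two graphs along a convex intersection\<close>

locale convex_gluing =
  fixes X G H :: "'a pair_pre_digraph"
  assumes G: "subgraph_of G X" and H: "subgraph_of H X"
    and union: "graph_union G H = X"
    and convex: "convex_in (graph_inter G H) X"
begin

abbreviation "U \<equiv> graph_inter G H"

text \<open>The projection stays outside the locale, which is therefore symmetric; facts about
  \<open>G\<close> thus transfer to \<open>H\<close>.\<close>

lemma swap: "convex_gluing X H G"
proof -
  have "graph_union H G = graph_union G H" "graph_inter H G = graph_inter G H"
    by (auto simp: graph_union_def graph_inter_def)
  with G H union convex show ?thesis by (simp add: convex_gluing_def)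
qed

lemma graphs: "pair_graph X" "pair_graph G" "pair_graph H" "pair_graph U"
  using G H convex by (auto simp: subgraph_of_def convex_in_def)

lemma pverts_U: "pverts U = pverts G \<inter> pverts H"
  and parcs_U: "parcs U = parcs G \<inter> parcs H"
  and pverts_X: "pverts X = pverts G \<union> pverts H"
  and parcs_X: "parcs X = parcs G \<union> parcs H"
  using union by (auto simp: graph_inter_def graph_union_def)

lemma arcs_verts:
  "(x, y) \<in> parcs G \<Longrightarrow> x \<in> pverts G \<and> y \<in> pverts G"
  "(x, y) \<in> parcs H \<Longrightarrow> x \<in> pverts H \<and> y \<in> pverts H"
  using graphs(2,3)
  by (meson pair_graph_def pair_digraph_def pair_fin_digraph_def pair_wf_digraph.in_arcsD1
      pair_wf_digraph.in_arcsD2)+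

text \<open>By convexity the distance in \<open>X\<close> is already attained inside
  \<open>U\<close>, which is a subgraph of \<open>G\<close>.\<close>

lemma gdist_G_le: "u \<in> pverts U \<Longrightarrow> v \<in> pverts U \<Longrightarrow> gdist G u v \<le> gdist X u v"
  using convex gdist_mono[OF graphs(4,2), of u v]
  by (simp add: convex_in_def pverts_U parcs_U)

text \<open>
  The two claims must be proved together: a walk from \<open>G\<close> that leaves \<open>G\<close> does so at a vertex
  of \<open>U\<close>, re-enters \<open>G\<close> through \<open>U\<close>, and by convexity the detour can be replaced by a walk in \<open>G\<close>.
\<close>
lemma walk_split:
  assumes "(x, y) \<in> parcs X ^^ n" "y \<in> pverts G"
  shows "(x \<in> pverts G \<longrightarrow> gdist G x y \<le> enat n) \<and>
    (x \<in> pverts H \<longrightarrow> (\<exists>u\<in>pverts U. gdist X x u + gdist G u y \<le> enat n))"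
  using assms(1)
proof (induct n arbitrary: x)
  case 0
  have "gdist G y y = 0" "gdist X y y = 0"
    using assms(2) graphs by (auto simp: gdist_self pverts_X)
  with 0 assms(2) show ?case
    by (auto simp: pverts_U zero_enat_def[symmetric] intro!: bexI[of _ y])
next
  case (Suc n)
  then obtain z where z: "(x, z) \<in> parcs X" "(z, y) \<in> parcs X ^^ n"
    by (meson relpow_Suc_D2)
  note IH = Suc.hyps[OF z(2)]
  \<comment> \<open>The arc ends in \<open>H\<close>, so the second half of the induction hypothesis
    at \<open>z\<close> supplies \<open>u\<close>, which also serves for \<open>x\<close>.\<close>
  have via_H: "\<exists>u\<in>pverts U. gdist X x u + gdist G u y \<le> enat (Suc n)" if "(x, z) \<in> parcs H"
    using IH arcs_verts(2)[OF that] gdist_step[OF graphs(1) z(1)] by blast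
  have in_G: "gdist G x y \<le> enat (Suc n)" if x: "x \<in> pverts G"
  proof (cases "(x, z) \<in> parcs G")
    case True
    then show ?thesis
      using IH arcs_verts(1) gdist_step[OF graphs(2) True, of y 0 n] by simp
  next
    case False
    then have "(x, z) \<in> parcs H" using z(1) parcs_X by auto
    then obtain u where u: "u \<in> pverts U" "gdist X x u + gdist G u y \<le> enat (Suc n)"
      and "x \<in> pverts U"
      using via_H arcs_verts(2) x pverts_U by blast
    have "gdist G x y \<le> gdist G x u + gdist G u y"
      using graphs(2) x u(1) by (intro gdist_triangle) (auto simp: pverts_U)
    also have "\<dots> \<le> gdist X x u + gdist G u y"
      using gdist_G_le[OF \<open>x \<in> pverts U\<close> u(1)] by (rule add_right_mono)
    finally show ?thesis using u(2) by simp
  qed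
  moreover have "\<exists>u\<in>pverts U. gdist X x u + gdist G u y \<le> enat (Suc n)" if x: "x \<in> pverts H"
  proof (cases "x \<in> pverts G")
    case True
    \<comment> \<open>The witness is \<open>x\<close> itself, at distance zero, so the second claim
      reduces to the first.\<close>
    with x show ?thesis
      using in_G gdist_self[OF graphs(1), of x] by (intro bexI[of _ x]) (auto simp: pverts_U pverts_X)
  next
    case False
    \<comment> \<open>An arc leaving a vertex outside \<open>G\<close> must belong to
      \<open>H\<close>.\<close>
    then show ?thesis using via_H z(1) arcs_verts(1) parcs_X by blast
  qed
  ultimately show ?case by blast
qed

text \<open>The first half of \<open>walk_split\<close>, for walks of every length, gives the
  nontrivial inequality. Hence \<open>G\<close> is convex in \<open>X\<close>, and by
  \<open>swap\<close> so is \<open>H\<close>.\<close>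

lemma gdist_G_eq:
  assumes "x \<in> pverts G" "y \<in> pverts G"
  shows "gdist G x y = gdist X x y"
proof (rule antisym)
  show "gdist G x y \<le> gdist X x y"
    using assms walk_split by (intro gdist_greatest[OF graphs(1)]) (auto simp: pverts_X)
  show "gdist X x y \<le> gdist G x y"
    using assms graphs by (intro gdist_mono) (auto simp: pverts_X parcs_X)
qed

text \<open>The second half of \<open>walk_split\<close> is applied to a shortest walk, which exists
  because the distance is finite.\<close>

lemma gdist_through_U:
  assumes "x \<in> pverts H" "y \<in> pverts G" "gdist X x y \<noteq> \<infinity>"
  shows "\<exists>u\<in>pverts U. gdist X x u + gdist X u y \<le> gdist X x y"
proof -
  obtain n where n: "gdist X x y = enat n" using assms(3) by auto
  then have "(x, y) \<in> parcs X ^^ n"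
    using gdist_relpow[OF graphs(1)] assms(1) pverts_X by blast
  with assms show ?thesis using walk_split[of x y n] gdist_G_eq n by (auto simp: pverts_U)
qed

text \<open>The projection only governs distances in \<open>H\<close> to \<open>U\<close>. Convexity
  of \<open>H\<close> moves them to \<open>X\<close>, and a geodesic from \<open>x\<close> to
  \<open>y\<close> meets \<open>U\<close> at some \<open>u\<close>, whence \<open>d(x,p) + d(p,y)
  \<le> d(x,p) + d(p,u) + d(u,y) = d(x,u) + d(u,y) \<le> d(x,y)\<close>.\<close>

lemma gdist_projection:
  assumes "projects_to H U" "x \<in> pverts H"
  shows "(\<exists>p\<in>pverts U. \<forall>y\<in>pverts G. gdist X x y = gdist X x p + gdist X p y) \<or>
    (\<forall>y\<in>pverts G. gdist X x y = \<infinity>)"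
proof (cases "x \<in> joined_verts H U")
  case True
  have eq: "gdist H u v = gdist X u v" if "u \<in> pverts H" "v \<in> pverts H" for u v
    using convex_gluing.gdist_G_eq[OF swap] that by blast
  from assms(1) True obtain p where p: "p \<in> pverts U"
    and pH: "\<forall>u\<in>pverts U. gdist H x u = gdist H x p + gdist H p u"
    unfolding projects_to_def by blast
  have UH: "u \<in> pverts H" if "u \<in> pverts U" for u
    using that pverts_U by blast
  have pu: "gdist X x u = gdist X x p + gdist X p u" if "u \<in> pverts U" for u
    using bspec[OF pH that]
    unfolding eq[OF assms(2) UH[OF that]] eq[OF assms(2) UH[OF p]] eq[OF UH[OF p] UH[OF that]] .
  have "gdist X x y = gdist X x p + gdist X p y" if y: "y \<in> pverts G" for y
  proof (rule antisym)
    show "gdist X x y \<le> gdist X x p + gdist X p y"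
      using graphs(1) assms(2) p by (intro gdist_triangle) (auto simp: pverts_U pverts_X)
    show "gdist X x p + gdist X p y \<le> gdist X x y"
    proof (cases "gdist X x y = \<infinity>")
      case False
      then obtain u where u: "u \<in> pverts U" "gdist X x u + gdist X u y \<le> gdist X x y"
        using gdist_through_U[OF assms(2) y] by blast
      have "gdist X p y \<le> gdist X p u + gdist X u y"
        using graphs(1) p u by (intro gdist_triangle) (auto simp: pverts_U pverts_X)
      then have "gdist X x p + gdist X p y \<le> gdist X x u + gdist X u y"
        using pu[OF u(1)] by (simp add: add.assoc add_left_mono)
      with u(2) show ?thesis by simp
    qed simp
  qed
  with p show ?thesis by blast
next
  case False
  \<comment> \<open>No path in \<open>H\<close> joins \<open>x\<close> to \<open>U\<close>, hence
    none in \<open>X\<close> by convexity of \<open>H\<close>; a finite distance to \<open>G\<close>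
    would require a route through \<open>U\<close>.\<close>
  have "gdist X x u = \<infinity>" if "u \<in> pverts U" for u
  proof -
    have "{p. vpath p (with_proj H) \<and> hd p = x \<and> last p = u} = {}"
      using False assms(2) that by (auto simp: joined_verts_def)
    then have "gdist H x u = \<infinity>" by (simp only: gdist_def INF_empty top_enat_def)
    then show ?thesis
      using convex_gluing.gdist_G_eq[OF swap, of x u] assms(2) that by (simp add: pverts_U)
  qed
  then have "gdist X x y = \<infinity>" if "y \<in> pverts G" for y
    using gdist_through_U[OF assms(2) that] by (cases "gdist X x y = \<infinity>") auto
  then show ?thesis by blast
qed

text \<open>The coefficients form one row of \<open>P\<close>: a single entry
  \<open>zeta X x p\<close> in column \<open>p\<close>, or the zero row when \<open>x\<close> is
  infinitely far from all of \<open>G\<close>.\<close>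

lemma zeta_factor:
  assumes "projects_to H U" "x \<in> pverts H"
  shows "\<exists>c. \<forall>y\<in>pverts G. zeta X x y = (\<Sum>u\<in>pverts U. c u * zeta X u y)"
  using gdist_projection[OF assms]
proof
  assume "\<exists>p\<in>pverts U. \<forall>y\<in>pverts G. gdist X x y = gdist X x p + gdist X p y"
  then obtain p where p: "p \<in> pverts U"
    and *: "\<And>y. y \<in> pverts G \<Longrightarrow> gdist X x y = gdist X x p + gdist X p y" by blast
  have fin: "finite (pverts U)"
    by (rule finite_pverts[OF graphs(4)])
  have "zeta X x y = (\<Sum>u\<in>pverts U. (if u = p then zeta X x p else 0) * zeta X u y)"
    if "y \<in> pverts G" for y
  proof -
    have "zeta X x y = zeta X x p * zeta X p y"
      using *[OF that] by (simp add: zeta_def Zmat_def qpow_add ratfun_of_int_poly.hom_mult)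
    also have "\<dots> = (\<Sum>u\<in>pverts U. (if u = p then zeta X x p else 0) * zeta X u y)"
      using p fin by (simp add: if_distrib[of "\<lambda>c. c * _"] cong: if_cong)
    finally show ?thesis .
  qed
  then show ?thesis by (intro exI[of _ "\<lambda>u. if u = p then zeta X x p else 0"]) blast
next
  assume "\<forall>y\<in>pverts G. gdist X x y = \<infinity>"
  then have "\<forall>y\<in>pverts G. zeta X x y = (\<Sum>u\<in>pverts U. 0 * zeta X u y)"
    by (simp add: zeta_def Zmat_def qpow_def)
  then show ?thesis by (intro exI[of _ "\<lambda>_. 0"])
qed

end

section \<open>Inclusion-exclusion for the magnitude\<close>

theorem theorem4p9:
  fixes X G H :: "'a pair_pre_digraph"
  assumes "pair_graph X"
    and "subgraph_of G X"
    and "subgraph_of H X"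
    and "graph_union G H = X"
    and "convex_in (graph_inter G H) X"
    and "projects_to H (graph_inter G H)"
  shows "magnitude X = magnitude G + magnitude H - magnitude (graph_inter G H)"
proof -
  interpret convex_gluing X G H using assms by unfold_locales
  have fin: "finite (pverts G)" "finite (pverts H)"
    using graphs finite_pverts by blast+
  obtain a b c where a: "weighting_on (pverts G) (zeta G) a"
    and b: "weighting_on (pverts H) (zeta H) b"
    and c: "weighting_on (pverts U) (zeta U) c"
    using ex_weighting_on_zeta graphs by metis
  obtain W where W: "is_inverse_on (pverts U) (zeta U) W"
    using ex_is_inverse_on_zeta graphs by metis
  have "\<forall>x\<in>pverts H. \<exists>c. \<forall>y\<in>pverts G. zeta X x y = (\<Sum>u\<in>pverts U. c u * zeta X u y)"
    using zeta_factor assms(6) by blast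
  then obtain P where P: "\<And>x y. x \<in> pverts H \<Longrightarrow> y \<in> pverts G \<Longrightarrow>
      zeta X x y = (\<Sum>u\<in>pverts U. P x u * zeta X u y)"
    by metis
  define w where "w x = (if x \<in> pverts G then a x else 0) + (if x \<in> pverts H then b x else 0)
      - (if x \<in> pverts G \<inter> pverts H then c x else 0)" for x
  \<comment> \<open>Convexity of \<open>G\<close>, \<open>H\<close> and \<open>U\<close> makes their
    matrices blocks of \<open>zeta X\<close>, so the gluing can be done within a single
    matrix.\<close>
  have G_eq: "zeta G x y = zeta X x y" if "x \<in> pverts G" "y \<in> pverts G" for x y
    using gdist_G_eq that by (simp add: zeta_def Zmat_def)
  have H_eq: "zeta H x y = zeta X x y" if "x \<in> pverts H" "y \<in> pverts H" for x y
    using convex_gluing.gdist_G_eq[OF swap] that by (simp add: zeta_def Zmat_def)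
  have U_eq: "zeta U x y = zeta X x y" if "x \<in> pverts U" "y \<in> pverts U" for x y
    using convex that by (simp add: zeta_def Zmat_def convex_in_def)
  have "weighting_on (pverts G \<union> pverts H) (zeta X) w"
    unfolding w_def
  proof (rule weighting_on_glue)
    show "is_inverse_on (pverts G \<inter> pverts H) (zeta X) W"
      using iffD1[OF is_inverse_on_cong[OF U_eq] W] by (simp add: pverts_U)
    show "weighting_on (pverts G) (zeta X) a"
      by (rule iffD1[OF weighting_on_cong[OF G_eq] a])
    show "weighting_on (pverts H) (zeta X) b"
      by (rule iffD1[OF weighting_on_cong[OF H_eq] b])
    show "weighting_on (pverts G \<inter> pverts H) (zeta X) c"
      using iffD1[OF weighting_on_cong[OF U_eq] c] by (simp add: pverts_U)
    show "zeta X x y = zeta X y x" if "x \<in> pverts G \<union> pverts H" "y \<in> pverts G \<union> pverts H" for x y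
      using gdist_commute[OF graphs(1)] that by (simp add: zeta_def Zmat_def pverts_X)
    show "zeta X x y = (\<Sum>u\<in>pverts G \<inter> pverts H. P x u * zeta X u y)"
      if "x \<in> pverts H" "y \<in> pverts G" for x y
      using P[OF that] by (simp add: pverts_U)
  qed (use fin in auto)
  then have "magnitude X = (\<Sum>x\<in>pverts G \<union> pverts H. w x)"
    using magnitude_eq_sum_weighting[OF graphs(1)] by (simp add: pverts_X)
  also have "\<dots> = (\<Sum>x\<in>pverts G. a x) + (\<Sum>x\<in>pverts H. b x) - (\<Sum>x\<in>pverts G \<inter> pverts H. c x)"
  proof -
    have ext: "(\<Sum>x\<in>pverts G \<union> pverts H. if x \<in> V then f x else 0) = sum f V"
      if "V \<subseteq> pverts G \<union> pverts H" for V and f :: "'a \<Rightarrow> ratfun"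
      using that fin by (intro sum.mono_neutral_cong_right) auto
    show ?thesis
      unfolding w_def sum.distrib sum_subtractf
      by (simp only: ext Un_upper1 Un_upper2 le_supI1 Int_lower1)
  qed
  also have "\<dots> = magnitude G + magnitude H - magnitude U"
    using magnitude_eq_sum_weighting[OF graphs(2) a] magnitude_eq_sum_weighting[OF graphs(3) b]
      magnitude_eq_sum_weighting[OF graphs(4) c]
    by (simp only: pverts_U)
  finally show ?thesis .
qed

end
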